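(* Let $N\colon\mathbb{B}^L\to\mathbb{B}^L$ be the reduced Boolean Delta-Notch system over a graph $\mathcal{G}$ as in the context. Every fixed point $x\in\mathbb{B}^L$ of $N$ is reachable in the asynchronous dynamics $AD_N$ both from the state $\mathbf{1}=(1,\dots,1)$ and from the state $\mathbf{0}=(0,\dots,0)$.
   Context: Let $L\ge 1$ and let $\mathcal{G}$ be an undirected connected graph without loops on the vertex set $C=\{1,\dots,L\}$. For $i\in C$ let $S(i)$ be the set of neighbours of $i$ in $\mathcal{G}$. $\mathbb{B}=\{0,1\}$. The reduced Boolean Delta-Notch system is $N\colon\mathbb{B}^L\to\mathbb{B}^L$, $N_i(n)=\bigvee_{j\in S(i)}(1-n_j)$ (empty disjunction $=0$). The asynchronous dynamics $AD_N$ is the directed graph on $\mathbb{B}^L$ with an edge from $x$ to the state obtained from $x$ by flipping coordinate $i$ whenever $N_i(x)\neq x_i$. A state $y$ is reachable from $x$ if there is a directed path (possibly of length zero) from $x$ to $y$. A fixed point is $x$ with $N(x)=x$. *)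

theory Defs
  imports "HOL-Library.FuncSet" "Graph_Theory.Digraph_Component"
begin

text \<open>
  The Boolean values 0 and 1 are \<^term>\<open>False\<close> and \<^term>\<open>True\<close>. An element of the \<open>L\<close>-fold
  power of \<^typ>\<open>bool\<close> is an extensional function on \<open>{1..L}\<close>, so that equality of states is
  equality of functions.
\<close>

definition states :: "nat \<Rightarrow> (nat \<Rightarrow> bool) set" where
  "states L = {1..L} \<rightarrow>\<^sub>E UNIV"

definition const_state :: "nat \<Rightarrow> bool \<Rightarrow> (nat \<Rightarrow> bool)" where
  "const_state L b = (\<lambda>i\<in>{1..L}. b)"

definition neighbours :: "nat pair_pre_digraph \<Rightarrow> nat \<Rightarrow> nat set" where
  "neighbours G i = {j. i \<rightarrow>\<^bsub>with_proj G\<^esub> j}"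

definition delta_notch :: "nat \<Rightarrow> nat pair_pre_digraph \<Rightarrow> (nat \<Rightarrow> bool) \<Rightarrow> (nat \<Rightarrow> bool)" where
  "delta_notch L G n = (\<lambda>i\<in>{1..L}. \<exists>j\<in>neighbours G i. \<not> n j)"

definition async_dynamics ::
  "nat \<Rightarrow> ((nat \<Rightarrow> bool) \<Rightarrow> (nat \<Rightarrow> bool)) \<Rightarrow> (nat \<Rightarrow> bool) pair_pre_digraph" where
  "async_dynamics L F =
     \<lparr> pverts = states L,
       parcs = {(x, x(i := \<not> x i)) | x i. x \<in> states L \<and> i \<in> {1..L} \<and> F x i \<noteq> x i} \<rparr>"

end

theory Submission
  imports Defs
begin

text \<open>
  Write \<open>x\<close> for a fixed point. At a vertex \<open>i\<close> with \<open>x\<^sub>i = 0\<close> all neighbours have value 1 in \<open>x\<close>,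
  hence in every state above \<open>x\<close>; so in such a state \<open>i\<close> may be switched off. Dually, a vertex
  with \<open>x\<^sub>i = 1\<close> has a neighbour with value 0 in \<open>x\<close>, hence in every state below \<open>x\<close>; so in such a
  state \<open>i\<close> may be switched on. Thus from either constant state the coordinates that differ from
  \<open>x\<close> can be flipped one at a time, in any order.
\<close>

lemma async_dynamics_step:
  assumes "y \<in> states L" and "i \<in> {1..L}" and "F y i \<noteq> y i"
  shows "y \<rightarrow>\<^bsub>with_proj (async_dynamics L F)\<^esub> y(i := \<not> y i)"
  using assms by (auto simp: async_dynamics_def arcs_ends_conv)

lemma states_fun_upd:
  assumes "y \<in> states L" and "i \<in> {1..L}"
  shows "y(i := b) \<in> states L"
  using assms by (auto simp: states_def PiE_iff extensional_def)

lemma wf_digraph_async_dynamics: "wf_digraph (with_proj (async_dynamics L F))"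
  by unfold_locales (auto simp: async_dynamics_def states_fun_upd)

lemma states_agree_outside:
  assumes "x \<in> states L" and "y \<in> states L" and "i \<notin> {1..L}"
  shows "x i = y i"
  using assms by (auto simp: states_def PiE_iff extensional_def)

text \<open>Induction on the Hamming distance from \<open>y\<close> to \<open>x\<close>. The
  hypothesis covers the whole box spanned by \<open>x\<close> and \<open>y\<close>, not just
  \<open>y\<close>, so that it survives each flip.\<close>

lemma async_reachable_if_pulled_towards:
  assumes "x \<in> states L" and "y \<in> states L"
    and "\<And>z i. \<lbrakk>z \<in> states L; \<forall>j. z j = x j \<or> z j = y j; i \<in> {1..L}; y i \<noteq> x i\<rbrakk>
           \<Longrightarrow> F z i = x i"
  shows "y \<rightarrow>\<^sup>*\<^bsub>with_proj (async_dynamics L F)\<^esub> x"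
  using assms(2,3)
proof (induction "card {i \<in> {1..L}. y i \<noteq> x i}" arbitrary: y rule: less_induct)
  case less
  interpret wf_digraph "with_proj (async_dynamics L F)"
    by (rule wf_digraph_async_dynamics)
  show ?case
  proof (cases "\<exists>i\<in>{1..L}. y i \<noteq> x i")
    case False
    then have "y = x"
      using states_agree_outside[OF assms(1) less.prems(1)] by (intro ext) metis
    moreover have "x \<in> verts (with_proj (async_dynamics L F))"
      using assms(1) by (simp add: async_dynamics_def)
    ultimately show ?thesis
      by simp
  next
    case True
    then obtain i where i: "i \<in> {1..L}" "y i \<noteq> x i"
      by blast
    let ?y = "y(i := \<not> y i)"
    have "F y i = x i"
      by (rule less.prems(2)) (use less.prems(1) i in simp_all)
    with i(2) have "F y i \<noteq> y i"
      by simp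
    then have step: "y \<rightarrow>\<^bsub>with_proj (async_dynamics L F)\<^esub> ?y"
      using async_dynamics_step less.prems(1) i(1) by blast
    have "{k \<in> {1..L}. ?y k \<noteq> x k} \<subset> {k \<in> {1..L}. y k \<noteq> x k}"
      using i by auto
    then have "card {k \<in> {1..L}. ?y k \<noteq> x k} < card {k \<in> {1..L}. y k \<noteq> x k}"
      by (intro psubset_card_mono) auto
    moreover have "?y \<in> states L"
      using less.prems(1) i(1) by (rule states_fun_upd)
    \<comment> \<open>Values are Boolean, so \<open>?y i = x i\<close>; hence the box spanned by
      \<open>x\<close> and \<open>?y\<close> lies inside the one spanned by \<open>x\<close> and
      \<open>y\<close>.\<close>
    moreover have "F z k = x k"
      if "z \<in> states L" "\<forall>j. z j = x j \<or> z j = ?y j" "k \<in> {1..L}" "?y k \<noteq> x k" for z k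
    proof (rule less.prems(2))
      show "\<forall>j. z j = x j \<or> z j = y j"
      proof
        fix j
        show "z j = x j \<or> z j = y j"
          using spec[OF that(2), of j] i(2) by (cases "j = i") auto
      qed
      show "y k \<noteq> x k"
        using that(4) i(2) by (cases "k = i") auto
    qed (rule that(1), rule that(3))
    ultimately have "?y \<rightarrow>\<^sup>*\<^bsub>with_proj (async_dynamics L F)\<^esub> x"
      by (rule less.hyps)
    with step show ?thesis
      by (rule adj_reachable_trans)
  qed
qed

lemma const_state_in_states: "const_state L b \<in> states L"
  by (simp add: const_state_def states_def)

text \<open>Where \<open>x\<close> already has the value \<open>b\<close>, the box has no freedom.
  Outside \<open>{1..L}\<close> this holds because extensional states agree there.\<close>

lemma between_const_state:
  assumes "x \<in> states L" and "\<forall>j. z j = x j \<or> z j = const_state L b j" and "x j = b"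
  shows "z j = b"
proof (cases "j \<in> {1..L}")
  case True
  then show ?thesis
    using spec[OF assms(2), of j] assms(3) by (auto simp: const_state_def)
next
  case False
  then show ?thesis
    using spec[OF assms(2), of j] assms(3) states_agree_outside[OF assms(1) const_state_in_states]
    by metis
qed

lemma const_state_reaches_fixed_point:
  assumes x: "x \<in> states L" and fp: "delta_notch L G x = x"
  shows "const_state L b \<rightarrow>\<^sup>*\<^bsub>with_proj (async_dynamics L (delta_notch L G))\<^esub> x"
proof (rule async_reachable_if_pulled_towards[OF x const_state_in_states])
  fix z i
  assume z: "\<forall>j. z j = x j \<or> z j = const_state L b j"
    and i: "i \<in> {1..L}" "const_state L b i \<noteq> x i"
  have xi: "x i = (\<exists>j\<in>neighbours G i. \<not> x j)"
    using fun_cong[OF fp, of i] i(1) by (simp add: delta_notch_def)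
  have "x i = (\<not> b)"
    using i by (auto simp: const_state_def)
  \<comment> \<open>If \<open>b\<close> is true, all neighbours of \<open>i\<close> are true in
    \<open>x\<close> and stay so in \<open>z\<close>. If \<open>b\<close> is false, a neighbour that
    is false in \<open>x\<close> is still a witness in \<open>z\<close>.\<close>
  then have "(\<exists>j\<in>neighbours G i. \<not> z j) = x i"
    using xi between_const_state[OF x z] by (cases b) blast+
  then show "delta_notch L G z i = x i"
    using i(1) by (simp add: delta_notch_def)
qed

theorem theorem5:
  fixes L :: nat and G :: "nat pair_pre_digraph" and x :: "nat \<Rightarrow> bool"
  assumes "L \<ge> 1"
    and "pair_graph G" and "pverts G = {1..L}" and "Digraph_Component.connected (with_proj G)"
    and "x \<in> states L" and "delta_notch L G x = x"
  shows "const_state L True \<rightarrow>\<^sup>*\<^bsub>with_proj (async_dynamics L (delta_notch L G))\<^esub> x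
       \<and> const_state L False \<rightarrow>\<^sup>*\<^bsub>with_proj (async_dynamics L (delta_notch L G))\<^esub> x"
  using const_state_reaches_fixed_point assms(5,6) by blast

end
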